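(* Let $N\ge1$, let $a_1,\dots,a_N\in\mathbb{R}\setminus\{0\}$ satisfy $$\forall S\subseteq\{1,\dots,N\},\ S\ne\emptyset,\qquad \sum_{i\in S}a_i\ne0,$$ let $\Omega=\mathbb{H}$ (open upper half-plane) or $\Omega=\mathbb{D}$ (open unit disk), and let $(x_i^0)_{1\le i\le N}$ be any family of pairwise distinct points in $\Omega$. Let $T\in(0,+\infty)$ and assume that the solution $(x_1,\dots,x_N)$ of the point-vortex system in $\Omega$ with intensities $a_i$ and initial positions $x_i^0$ is defined on $[0,T)$. Let $$Q=\Big\{i\in\{1,\dots,N\}:\ \liminf_{t\to T}\operatorname{dist}(x_i(t),\partial\Omega)=0\Big\}.$$ If either $\Omega=\mathbb{H}$ and $M(0)\cdot e_2\ne0$, or $\Omega=\mathbb{D}$ and $I(0)\ne\sum_{i=1}^Na_i$, where $$M(0)=\sum_{i=1}^Na_ix_i^0,\qquad I(0)=\sum_{i=1}^Na_i|x_i^0|^2,\qquad e_2=(0,1),$$ then $Q\ne\{1,\dots,N\}$.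
   Context: For $x=(x_1,x_2)\in\mathbb{R}^2$ write $x^\perp=(-x_2,x_1)$, $\nabla^\perp=(-\partial_2,\partial_1)$, $\bar x=(x_1,-x_2)$; $\nabla_x$ is the gradient in the first variable. $\mathbb{H}=\{x_2>0\}$, $\mathbb{D}=\{|x|<1\}$. The point-vortex system in $\Omega\in\{\mathbb{H},\mathbb{D}\}$ is $$\frac{\mathrm{d}}{\mathrm{d}t}x_i(t)=\sum_{\substack{j=1\\ j\ne i}}^N a_j\,\nabla_x^\perp G_\Omega(x_i(t),x_j(t))+\frac{a_i}{2}\nabla^\perp\widetilde\gamma_\Omega(x_i(t)),\qquad x_i(0)=x_i^0,$$ where a solution on $[0,T)$ has pairwise distinct $x_i(t)\in\Omega$ for each $t\in[0,T)$, and $$G_{\mathbb{H}}(x,y)=\frac1{2\pi}\ln\frac{|x-y|}{|x-\bar y|},\quad \widetilde\gamma_{\mathbb{H}}(x)=-\frac1{2\pi}\ln(2x_2),\quad G_{\mathbb{D}}(x,y)=\frac1{2\pi}\ln\frac{|x-y|}{|x\bar y-1|},\quad \widetilde\gamma_{\mathbb{D}}(x)=-\frac1{2\pi}\ln(1-|x|^2),$$ with $x\bar y$ in $G_{\mathbb{D}}$ denoting the product of complex numbers. *)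

theory Defs
  imports "HOL-Analysis.Analysis"
begin

text \<open>The plane is identified with \<^typ>\<open>complex\<close>: \<open>(x\<^sub>1, x\<^sub>2)\<close> is \<open>Complex x\<^sub>1 x\<^sub>2\<close>, the reflection
  \<open>(x\<^sub>1, - x\<^sub>2)\<close> is \<^const>\<open>cnj\<close>, and the scalar product is the real inner product on \<^typ>\<open>complex\<close>.\<close>

datatype vortex_domain = Half_Plane | Disk

primrec region :: "vortex_domain \<Rightarrow> complex set" where
  "region Half_Plane = {z. Im z > 0}"
| "region Disk = ball 0 1"

primrec green :: "vortex_domain \<Rightarrow> complex \<Rightarrow> complex \<Rightarrow> real" where
  "green Half_Plane x y = 1 / (2 * pi) * ln (norm (x - y) / norm (x - cnj y))"
| "green Disk x y = 1 / (2 * pi) * ln (norm (x - y) / norm (x * cnj y - 1))"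

text \<open>The Robin function, i.e. the diagonal of the regular part of \<^const>\<open>green\<close>.\<close>

primrec robin :: "vortex_domain \<Rightarrow> complex \<Rightarrow> real" where
  "robin Half_Plane x = - 1 / (2 * pi) * ln (2 * Im x)"
| "robin Disk x = - 1 / (2 * pi) * ln (1 - (norm x)\<^sup>2)"

definition nabla_perp :: "(complex \<Rightarrow> real) \<Rightarrow> complex \<Rightarrow> complex" where
  "nabla_perp f x =
     Complex (- deriv (\<lambda>s. f (Complex (Re x) s)) (Im x)) (deriv (\<lambda>s. f (Complex s (Im x))) (Re x))"

text \<open>At \<open>t = 0\<close> the derivative below is one-sided.\<close>

definition point_vortex_solution ::
  "vortex_domain \<Rightarrow> nat \<Rightarrow> (nat \<Rightarrow> real) \<Rightarrow> (nat \<Rightarrow> complex) \<Rightarrow> real \<Rightarrow> (nat \<Rightarrow> real \<Rightarrow> complex) \<Rightarrow> bool"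
where
  "point_vortex_solution \<Omega> N a x0 T x \<longleftrightarrow>
     (\<forall>i\<in>{1..N}. x i 0 = x0 i) \<and>
     (\<forall>t\<in>{0..<T}. (\<forall>i\<in>{1..N}. x i t \<in> region \<Omega>) \<and> inj_on (\<lambda>i. x i t) {1..N}) \<and>
     (\<forall>t\<in>{0..<T}. \<forall>i\<in>{1..N}.
        (x i has_vector_derivative
           (\<Sum>j\<in>{1..N} - {i}. a j *\<^sub>R nabla_perp (\<lambda>z. green \<Omega> z (x j t)) (x i t))
           + (a i / 2) *\<^sub>R nabla_perp (robin \<Omega>) (x i t))
        (at t within {0..<T}))"

definition boundary_collision_set ::
  "vortex_domain \<Rightarrow> nat \<Rightarrow> real \<Rightarrow> (nat \<Rightarrow> real \<Rightarrow> complex) \<Rightarrow> nat set"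
where
  "boundary_collision_set \<Omega> N T x =
     {i \<in> {1..N}. Liminf (at_left T) (\<lambda>t. ereal (infdist (x i t) (frontier (region \<Omega>)))) = 0}"

definition vorticity_vector :: "nat \<Rightarrow> (nat \<Rightarrow> real) \<Rightarrow> (nat \<Rightarrow> complex) \<Rightarrow> complex" where
  "vorticity_vector N a z = (\<Sum>i=1..N. a i *\<^sub>R z i)"

definition moment_of_inertia :: "nat \<Rightarrow> (nat \<Rightarrow> real) \<Rightarrow> (nat \<Rightarrow> complex) \<Rightarrow> real" where
  "moment_of_inertia N a z = (\<Sum>i=1..N. a i * (norm (z i))\<^sup>2)"

end

theory Submission
  imports Defs
begin

text \<open>Let the height of a point be \<open>Im z\<close> in the half plane and \<open>1 - (norm z)\<^sup>2\<close> in the disk. In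
both cases the hypothesis on the initial data says that the weighted sum of the heights,
\<open>\<Sum>i. a i * height (x i)\<close>, is not zero, and this sum is conserved: the height of a vortex is
changed by the others through an antisymmetric flux (\<open>flux_antisym\<close>), and not at all by the Robin
function. If all vortices approached the boundary at the same time, the sum would tend to zero. The
difficulty is that a vanishing lower limit for each vortex only gives separate sequences of times for
different vortices.

It suffices to show that every height has a limit in \<open>[0, \<infinity>]\<close> at time \<open>T\<close>. Only two further facts
about the system are used: the flux between two vortices times the difference of their heights
is bounded (\<open>flux_bound\<close>), and no subset of the intensities has sum zero. Take a limit point
of the heights as \<open>t \<rightarrow> T\<close> with the largest number of clusters, that is, of distinct finite
values. While the trajectory is close to this point, its clusters are separated and their weighted
sums are Lipschitz in time. If the trajectory left a small neighbourhood infinitely often, the exit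
points would accumulate at another limit point, with the same weighted sum over each cluster because
the excursions become arbitrarily short in time. As no cluster has total weight zero, a cluster
that has not split cannot have moved. So some cluster has split, or a vortex has come back from
infinity, and the new limit point has more clusters, which is a contradiction (\<open>escape\<close>).\<close>

section \<open>Convergence of interacting heights\<close>

lemma finite_family_convergent_subsequence:
  fixes f :: "'i \<Rightarrow> nat \<Rightarrow> real"
  assumes "finite I" "\<And>i. i \<in> I \<Longrightarrow> bounded (range (f i))"
  shows "\<exists>\<rho> w. strict_mono \<rho> \<and> (\<forall>i\<in>I. (\<lambda>n. f i (\<rho> n)) \<longlonglongrightarrow> w i)"
  using assms
proof (induction I)
  case empty
  show ?case by (auto intro: exI[of _ id] simp: strict_mono_id)
next
  case (insert k I)
  then obtain \<rho> w where \<rho>: "strict_mono \<rho>" "\<And>i. i \<in> I \<Longrightarrow> (\<lambda>n. f i (\<rho> n)) \<longlonglongrightarrow> w i"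
    by blast
  have "bounded (range (\<lambda>n. f k (\<rho> n)))"
    using insert.prems[of k] by (rule bounded_subset) auto
  then obtain l \<sigma> where \<sigma>: "strict_mono \<sigma>" "((\<lambda>n. f k (\<rho> n)) \<circ> \<sigma>) \<longlonglongrightarrow> l"
    using bounded_imp_convergent_subsequence by blast
  have "(\<lambda>n. f i ((\<rho> \<circ> \<sigma>) n)) \<longlonglongrightarrow> (w(k := l)) i" if "i \<in> insert k I" for i
  proof (cases "i = k")
    case False
    then show ?thesis
      using that LIMSEQ_subseq_LIMSEQ[OF \<rho>(2) \<sigma>(1), of i] by (simp add: o_def)
  qed (use \<sigma> in \<open>simp add: o_def\<close>)
  then show ?case using strict_mono_o[OF \<rho>(1) \<sigma>(1)] by blast
qed

lemma first_crossing:
  fixes g :: "real \<Rightarrow> real"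
  assumes "continuous_on {s..b} g" "s \<le> b" "g s < r" "r \<le> g b"
  obtains \<tau> where "\<tau> \<in> {s..b}" "g \<tau> = r" "\<And>t. t \<in> {s..\<tau>} \<Longrightarrow> g t \<le> r"
proof -
  define A where "A = {s..b} \<inter> g -` {r..}"
  have "compact A"
    unfolding A_def using assms(1)
    by (metis closed_atLeast closed_atLeastAtMost compact_Icc compact_Int_closed
        continuous_on_closed_vimage inf.right_idem inf_commute)
  moreover have "A \<noteq> {}" using assms by (auto simp: A_def)
  ultimately have "\<exists>\<tau>\<in>A. \<forall>t\<in>A. \<tau> \<le> t" by (rule compact_attains_inf)
  then obtain \<tau> where \<tau>: "\<tau> \<in> A" "\<And>t. t \<in> A \<Longrightarrow> \<tau> \<le> t" by blast
  have "continuous_on {s..\<tau>} g"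
    using assms(1) by (rule continuous_on_subset) (use \<tau> in \<open>auto simp: A_def\<close>)
  then obtain x where x: "s \<le> x" "x \<le> \<tau>" "g x = r"
    using IVT'[of g s r \<tau>] \<tau> assms by (auto simp: A_def)
  then have "x \<in> A" using \<tau> by (auto simp: A_def)
  with \<tau>(2) x have "x = \<tau>" by force
  show ?thesis
  proof
    show "\<tau> \<in> {s..b}" using \<tau> by (auto simp: A_def)
    show "g \<tau> = r" using x \<open>x = \<tau>\<close> by simp
    show "g t \<le> r" if "t \<in> {s..\<tau>}" for t
    proof (rule ccontr)
      assume "\<not> g t \<le> r"
      then have "t \<in> A" using that \<tau> by (auto simp: A_def)
      then have "t = \<tau>" using \<tau>(2) that by force
      then show False using \<open>g \<tau> = r\<close> \<open>\<not> g t \<le> r\<close> by simp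
    qed
  qed
qed

text \<open>The heights of vortices in either domain obey the following scalar system, in which nothing is
left of the plane but an antisymmetric interaction that is at most inversely proportional to the
difference of the heights. The heights are shifted to be at least \<open>1\<close>, so that their reciprocals
stay in \<open>]0, 1]\<close> and a height that escapes to infinity has reciprocal limit \<open>0\<close>.\<close>

locale interacting_heights =
  fixes I :: "'i set" and a :: "'i \<Rightarrow> real" and H :: "'i \<Rightarrow> real \<Rightarrow> real"
    and K :: "'i \<Rightarrow> 'i \<Rightarrow> real \<Rightarrow> real" and C T :: real
  assumes finite_I: "finite I"
    and T_pos: "0 < T"
    and nonneutral: "\<And>S. S \<subseteq> I \<Longrightarrow> S \<noteq> {} \<Longrightarrow> sum a S \<noteq> 0"
    and H_ge_1: "\<And>i t. i \<in> I \<Longrightarrow> t \<in> {0..<T} \<Longrightarrow> 1 \<le> H i t"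
    and H_deriv: "\<And>i t. i \<in> I \<Longrightarrow> t \<in> {0..<T} \<Longrightarrow>
      (H i has_field_derivative (\<Sum>j\<in>I - {i}. a j * K i j t)) (at t within {0..<T})"
    and K_antisym: "\<And>i j t. K i j t = - K j i t"
    and K_bound: "\<And>i j t. i \<in> I \<Longrightarrow> j \<in> I \<Longrightarrow> t \<in> {0..<T} \<Longrightarrow> \<bar>K i j t\<bar> * \<bar>H i t - H j t\<bar> \<le> C"
begin

text \<open>Inside a cluster the antisymmetric interactions cancel in pairs, so only the vortices outside act on
its weighted sum. This makes the total a conserved quantity, and the sum over a cluster Lipschitz
for as long as the cluster is separated from the others in height.\<close>

lemma cluster_sum_deriv:
  assumes S: "S \<subseteq> I" and t: "t \<in> {0..<T}"
  shows "((\<lambda>t. \<Sum>i\<in>S. a i * H i t) has_field_derivative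
    (\<Sum>i\<in>S. \<Sum>j\<in>I - S. a i * a j * K i j t)) (at t within {0..<T})"
proof -
  have fin: "finite S" using S finite_I finite_subset by blast
  define k where "k = (\<lambda>i j. a i * a j * K i j t)"
  have anti: "k i j = - k j i" for i j
    unfolding k_def using K_antisym[of i j t] by simp
  have "(\<Sum>i\<in>S. \<Sum>j\<in>S. k i j) = (\<Sum>i\<in>S. \<Sum>j\<in>S. k j i)"
    by (rule sum.swap)
  also have "\<dots> = - (\<Sum>i\<in>S. \<Sum>j\<in>S. k i j)"
    by (subst anti) (simp add: sum_negf)
  finally have inner: "(\<Sum>i\<in>S. \<Sum>j\<in>S. k i j) = 0" by simp
  have "(\<Sum>i\<in>S. a i * (\<Sum>j\<in>I - {i}. a j * K i j t)) = (\<Sum>i\<in>S. \<Sum>j\<in>I. k i j)"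
  proof (rule sum.cong)
    fix i assume "i \<in> S"
    then have "(\<Sum>j\<in>I. k i j) = k i i + (\<Sum>j\<in>I - {i}. k i j)"
      using S finite_I by (intro sum.remove) auto
    moreover have "k i i = 0" using anti[of i i] by simp
    ultimately show "a i * (\<Sum>j\<in>I - {i}. a j * K i j t) = (\<Sum>j\<in>I. k i j)"
      by (simp add: k_def sum_distrib_left mult.assoc)
  qed simp
  also have "\<dots> = (\<Sum>i\<in>S. (\<Sum>j\<in>I - S. k i j) + (\<Sum>j\<in>S. k i j))"
    by (intro sum.cong sum.subset_diff finite_I S refl)
  also have "\<dots> = (\<Sum>i\<in>S. \<Sum>j\<in>I - S. k i j)"
    by (simp add: sum.distrib inner)
  finally have eq: "(\<Sum>i\<in>S. a i * (\<Sum>j\<in>I - {i}. a j * K i j t)) = (\<Sum>i\<in>S. \<Sum>j\<in>I - S. k i j)" .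
  have "((\<lambda>t. \<Sum>i\<in>S. a i * H i t) has_field_derivative
     (\<Sum>i\<in>S. a i * (\<Sum>j\<in>I - {i}. a j * K i j t))) (at t within {0..<T})"
    by (intro DERIV_sum DERIV_cmult H_deriv t) (use S in auto)
  then show ?thesis unfolding eq by (simp add: k_def)
qed

lemma total_conserved:
  assumes "t \<in> {0..<T}"
  shows "(\<Sum>i\<in>I. a i * H i t) = (\<Sum>i\<in>I. a i * H i 0)"
proof -
  have "((\<lambda>t. \<Sum>i\<in>I. a i * H i t) has_field_derivative 0) (at t within {0..<T})"
    if "t \<in> {0..<T}" for t
    using cluster_sum_deriv[OF order_refl that] by simp
  then obtain c where "\<And>t. t \<in> {0..<T} \<Longrightarrow> (\<Sum>i\<in>I. a i * H i t) = c"
    using has_field_derivative_zero_constant[of "{0..<T}" "\<lambda>t. \<Sum>i\<in>I. a i * H i t"] by auto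
  then show ?thesis using assms T_pos by simp
qed

lemma cluster_sum_lipschitz:
  assumes S: "S \<subseteq> I" and r: "0 < r" and s: "0 \<le> s" "s \<le> \<tau>" "\<tau> < T"
    and sep: "\<And>t i j. t \<in> {s..\<tau>} \<Longrightarrow> i \<in> S \<Longrightarrow> j \<in> I - S \<Longrightarrow> r \<le> \<bar>H i t - H j t\<bar>"
  shows "\<bar>(\<Sum>i\<in>S. a i * H i \<tau>) - (\<Sum>i\<in>S. a i * H i s)\<bar>
    \<le> (\<Sum>i\<in>S. \<Sum>j\<in>I - S. \<bar>a i\<bar> * \<bar>a j\<bar> * (C / r)) * (\<tau> - s)"
proof -
  let ?B = "\<Sum>i\<in>S. \<Sum>j\<in>I - S. \<bar>a i\<bar> * \<bar>a j\<bar> * (C / r)"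
  have "norm ((\<Sum>i\<in>S. a i * H i \<tau>) - (\<Sum>i\<in>S. a i * H i s)) \<le> ?B * norm (\<tau> - s)"
  proof (rule field_differentiable_bound[where S = "{s..\<tau>}"])
    fix t assume t: "t \<in> {s..\<tau>}"
    then have t': "t \<in> {0..<T}" using s by auto
    show "((\<lambda>t. \<Sum>i\<in>S. a i * H i t) has_field_derivative
        (\<Sum>i\<in>S. \<Sum>j\<in>I - S. a i * a j * K i j t)) (at t within {s..\<tau>})"
      using cluster_sum_deriv[OF S t'] by (rule DERIV_subset) (use s in auto)
    have "\<bar>a i * a j * K i j t\<bar> \<le> \<bar>a i\<bar> * \<bar>a j\<bar> * (C / r)" if "i \<in> S" "j \<in> I - S" for i j
    proof -
      have "\<bar>K i j t\<bar> * r \<le> \<bar>K i j t\<bar> * \<bar>H i t - H j t\<bar>"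
        using sep[OF t that] by (intro mult_left_mono) auto
      also have "\<dots> \<le> C" using that S t' by (intro K_bound) auto
      finally have "\<bar>K i j t\<bar> \<le> C / r" using r by (simp add: pos_le_divide_eq)
      then show ?thesis unfolding abs_mult by (rule mult_left_mono) simp
    qed
    then show "norm (\<Sum>i\<in>S. \<Sum>j\<in>I - S. a i * a j * K i j t) \<le> ?B"
      unfolding real_norm_def
      by (intro order_trans[OF sum_abs] sum_mono) blast
  qed (use s in auto)
  then show ?thesis using s by simp
qed

definition inv_height :: "'i \<Rightarrow> real \<Rightarrow> real" where
  "inv_height i t = 1 / H i t"

text \<open>The limit points at time \<open>T\<close> of the trajectory of reciprocals. These live in a compact cube, so
they exist although the heights themselves may be unbounded.\<close>

definition limit_configuration :: "('i \<Rightarrow> real) \<Rightarrow> bool" where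
  "limit_configuration w \<longleftrightarrow> (\<exists>t. (\<forall>n. t n \<in> {0..<T}) \<and> t \<longlonglongrightarrow> T \<and>
     (\<forall>i\<in>I. (\<lambda>n. inv_height i (t n)) \<longlonglongrightarrow> w i))"

text \<open>The vortices at value \<open>0\<close> are those escaping to infinity; nothing controls the differences of their
heights relative to each other, so they do not count as a cluster. With this choice the number
increases whether a cluster splits or a vortex comes back from infinity.\<close>

definition num_clusters :: "('i \<Rightarrow> real) \<Rightarrow> nat" where
  "num_clusters w = card (w ` I - {0})"

lemma inv_height_bounds:
  assumes "i \<in> I" "t \<in> {0..<T}"
  shows "0 < inv_height i t" "inv_height i t \<le> 1" "H i t = 1 / inv_height i t"
  using H_ge_1[OF assms] by (auto simp: inv_height_def)

text \<open>Separation of the reciprocals is the stronger condition, so neighbourhoods of a limit configuration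
may be measured in reciprocals while the Lipschitz bound is in terms of heights.\<close>

lemma inv_height_diff_le:
  assumes "i \<in> I" "j \<in> I" "t \<in> {0..<T}"
  shows "\<bar>inv_height i t - inv_height j t\<bar> \<le> \<bar>H i t - H j t\<bar>"
proof -
  have H: "1 \<le> H i t" "1 \<le> H j t" using assms H_ge_1 by auto
  have "\<bar>inv_height i t - inv_height j t\<bar> = \<bar>H i t - H j t\<bar> / (H i t * H j t)"
    using H by (simp add: inv_height_def diff_frac_eq abs_mult abs_minus_commute)
  also have "\<dots> \<le> \<bar>H i t - H j t\<bar> / 1"
    using H mult_mono[of 1 "H i t" 1 "H j t"] by (intro divide_left_mono) auto
  finally show ?thesis by simp
qed

lemma continuous_on_inv_height:
  assumes "i \<in> I"
  shows "continuous_on {0..<T} (inv_height i)"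
proof -
  have "continuous_on {0..<T} (H i)"
    using H_deriv[OF assms] by (intro DERIV_continuous_on) auto
  moreover have "H i t \<noteq> 0" if "t \<in> {0..<T}" for t
    using H_ge_1[OF assms that] by auto
  ultimately show ?thesis
    unfolding inv_height_def by (intro continuous_intros) auto
qed

lemma limit_configuration_subseq:
  assumes "\<And>n. t n \<in> {0..<T}" "t \<longlonglongrightarrow> T"
  obtains w \<rho> where "strict_mono \<rho>" "limit_configuration w"
    "\<And>i. i \<in> I \<Longrightarrow> (\<lambda>n. inv_height i (t (\<rho> n))) \<longlonglongrightarrow> w i"
proof -
  have "bounded (range (\<lambda>n. inv_height i (t n)))" if "i \<in> I" for i
    using inv_height_bounds(1,2)[OF that assms(1)]
    by (intro boundedI[of _ 1]) (auto simp: abs_le_iff less_imp_le order_trans[of _ 0])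
  from finite_family_convergent_subsequence[of I "\<lambda>i n. inv_height i (t n)", OF finite_I this] obtain \<rho> w
    where \<rho>: "strict_mono \<rho>" "\<forall>i\<in>I. (\<lambda>n. inv_height i (t (\<rho> n))) \<longlonglongrightarrow> w i" by blast
  have "limit_configuration w"
    unfolding limit_configuration_def
    using \<rho> assms LIMSEQ_subseq_LIMSEQ[OF assms(2) \<rho>(1)] 
    by (intro exI[of _ "t \<circ> \<rho>"]) (auto simp: o_def)
  then show ?thesis using \<rho> that by blast
qed

lemma limit_configuration_exists: "\<exists>w. limit_configuration w"
proof -
  define t where "t = (\<lambda>n. T - T * inverse (real (Suc n)))"
  have "t n \<in> {0..<T}" for n
    using T_pos by (auto simp: t_def field_simps)
  moreover have "t \<longlonglongrightarrow> T - T * 0"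
    unfolding t_def by (intro tendsto_intros LIMSEQ_inverse_real_of_nat)
  ultimately show ?thesis using limit_configuration_subseq[of t] by (metis diff_zero mult_zero_right)
qed

lemma limit_configuration_nonneg:
  assumes "limit_configuration w" "i \<in> I"
  shows "0 \<le> w i"
proof -
  obtain t where t: "\<And>n. t n \<in> {0..<T}" "(\<lambda>n. inv_height i (t n)) \<longlonglongrightarrow> w i"
    using assms by (auto simp: limit_configuration_def)
  show ?thesis
    by (rule LIMSEQ_le_const[OF t(2)]) (use inv_height_bounds(1)[OF assms(2) t(1)] in \<open>auto intro: less_imp_le\<close>)
qed

text \<open>The factor \<open>4\<close> leaves a gap of at least \<open>2 * r\<close> between different clusters after every value has
moved by at most \<open>r\<close>.\<close>

lemma positive_separation:
  fixes e :: real
  assumes "0 < e"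
  shows "\<exists>r>0. r \<le> e \<and> (\<forall>i\<in>I. \<forall>j\<in>I. w i \<noteq> w j \<longrightarrow> 4 * r \<le> \<bar>w i - w j\<bar>)
    \<and> (\<forall>i\<in>I. w i \<noteq> 0 \<longrightarrow> 4 * r \<le> \<bar>w i\<bar>)"
proof -
  define D where "D = insert e ((\<lambda>(x, y). \<bar>x - y\<bar> / 4) ` (insert 0 (w ` I) \<times> insert 0 (w ` I)) - {0 :: real})"
  have fin: "finite D" and pos: "\<And>d. d \<in> D \<Longrightarrow> 0 < d"
    using finite_I assms by (auto simp: D_def)
  define r where "r = Min D"
  have le: "r \<le> d" if "d \<in> D" for d unfolding r_def using fin that by simp
  have D: "\<bar>x - y\<bar> / 4 \<in> D" if "x \<in> insert 0 (w ` I)" "y \<in> insert 0 (w ` I)" "x \<noteq> y" for x y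
    unfolding D_def using that by (intro insertI2 DiffI image_eqI[of _ _ "(x, y)"]) auto
  have "0 < r" unfolding r_def using fin pos by (intro pos Min_in) (auto simp: D_def)
  moreover have "r \<le> e" by (rule le) (simp add: D_def)
  moreover have "4 * r \<le> \<bar>w i - w j\<bar>" if "i \<in> I" "j \<in> I" "w i \<noteq> w j" for i j
    using le[OF D[of "w i" "w j"]] that by auto
  moreover have "4 * r \<le> \<bar>w i\<bar>" if "i \<in> I" "w i \<noteq> 0" for i
    using le[OF D[of "w i" 0]] that by auto
  ultimately show ?thesis by blast
qed

text \<open>A perturbation smaller than the gaps keeps different clusters apart and away from \<open>0\<close>, so one value
per old cluster is a family of distinct new values. One more new value comes from the vortex \<open>i\<close>
if it leaves the value \<open>0\<close>, and otherwise from one of \<open>i\<close>, \<open>j\<close>, which cannot both have the value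
selected for their old cluster.\<close>

lemma num_clusters_less_if_split:
  assumes r: "0 < r"
    and sep: "\<And>i j. i \<in> I \<Longrightarrow> j \<in> I \<Longrightarrow> w i \<noteq> w j \<Longrightarrow> 4 * r \<le> \<bar>w i - w j\<bar>"
    and sep0: "\<And>i. i \<in> I \<Longrightarrow> w i \<noteq> 0 \<Longrightarrow> 4 * r \<le> \<bar>w i\<bar>"
    and near: "\<And>i. i \<in> I \<Longrightarrow> \<bar>q i - w i\<bar> \<le> r"
    and split: "i \<in> I" "j \<in> I" "w j = w i" "w i = 0 \<Longrightarrow> q i \<noteq> 0" "w i \<noteq> 0 \<Longrightarrow> q j \<noteq> q i"
  shows "num_clusters w < num_clusters q"
proof -
  define rep where "rep = (\<lambda>v. SOME k. k \<in> I \<and> w k = v)"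
  have rep: "rep v \<in> I \<and> w (rep v) = v" if "v \<in> w ` I" for v
    unfolding rep_def using that by (intro someI_ex[of "\<lambda>k. k \<in> I \<and> w k = v"]) auto
  define P where "P = w ` I - {0}"
  have q0: "q k \<noteq> 0" if "k \<in> I" "w k \<noteq> 0" for k
    using sep0[OF that] near[OF that(1)] r by linarith
  have qne: "q k \<noteq> q l" if "k \<in> I" "l \<in> I" "w k \<noteq> w l" for k l
    using sep[OF that] near[OF that(1)] near[OF that(2)] r by linarith
  obtain k where k: "k \<in> I" "q k \<noteq> 0" "w k \<noteq> 0 \<Longrightarrow> q k \<noteq> q (rep (w k))"
  proof (cases "w i = 0 \<or> q i \<noteq> q (rep (w i))")
    case True
    show ?thesis
    proof (rule that[of i])
      show "q i \<noteq> 0" using split(1,4) q0 by blast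
    qed (use True split in blast)+
  next
    case False
    then have "w i \<noteq> 0" "q i = q (rep (w i))" by simp_all
    show ?thesis
    proof (rule that[of j])
      show "q j \<noteq> 0" using q0[OF split(2)] split(3) \<open>w i \<noteq> 0\<close> by simp
      show "q j \<noteq> q (rep (w j))" using split(3,5) \<open>w i \<noteq> 0\<close> \<open>q i = _\<close> by simp
    qed (rule split)
  qed
  have inj: "inj_on (\<lambda>v. q (rep v)) P"
  proof (rule inj_onI)
    fix v v' assume v: "v \<in> P" "v' \<in> P" "q (rep v) = q (rep v')"
    have "rep v \<in> I" "w (rep v) = v" "rep v' \<in> I" "w (rep v') = v'"
      using rep v(1,2) by (auto simp: P_def)
    then show "v = v'" using qne[of "rep v" "rep v'"] v(3) by auto
  qed
  have "q k \<notin> (\<lambda>v. q (rep v)) ` P"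
  proof
    assume "q k \<in> (\<lambda>v. q (rep v)) ` P"
    then obtain v where v: "v \<in> w ` I" "v \<noteq> 0" "q k = q (rep v)" by (auto simp: P_def)
    have "rep v \<in> I" "w (rep v) = v" using rep[OF v(1)] by auto
    then have "w k = v" using qne[OF k(1), of "rep v"] v(3) by auto
    then show False using k v by blast
  qed
  then have "Suc (card P) = card (insert (q k) ((\<lambda>v. q (rep v)) ` P))"
    using inj finite_I by (simp add: card_image P_def)
  also have "\<dots> \<le> num_clusters q"
    unfolding num_clusters_def
  proof (rule card_mono)
    show "insert (q k) ((\<lambda>v. q (rep v)) ` P) \<subseteq> q ` I - {0}"
      using k rep q0 by (auto simp: P_def) 
  qed (use finite_I in simp)
  finally show ?thesis by (simp add: num_clusters_def P_def)
qed

text \<open>If one coordinate does not converge, the trajectory comes back to \<open>w\<close> arbitrarily closely and later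
leaves its neighbourhood of size \<open>r\<close>; the first exit time keeps the whole path in between inside.
The distance is the sum of the deviations, which bounds each of them and is continuous.\<close>

lemma excursion:
  assumes lim: "limit_configuration w" and i0: "i0 \<in> I"
    and freq: "\<exists>\<^sub>F t in at_left T. e \<le> \<bar>inv_height i0 t - w i0\<bar>" and r: "0 < r" "r \<le> e" and d: "0 < d"
  shows "\<exists>s \<tau>. 0 \<le> s \<and> T - d < s \<and> s \<le> \<tau> \<and> \<tau> < T \<and> (\<forall>i\<in>I. \<bar>inv_height i s - w i\<bar> < d) \<and>
    (\<forall>t\<in>{s..\<tau>}. (\<Sum>i\<in>I. \<bar>inv_height i t - w i\<bar>) \<le> r) \<and> (\<Sum>i\<in>I. \<bar>inv_height i \<tau> - w i\<bar>) = r"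
proof -
  define g where "g = (\<lambda>t. \<Sum>i\<in>I. \<bar>inv_height i t - w i\<bar>)"
  have g_ge: "\<bar>inv_height i t - w i\<bar> \<le> g t" if "i \<in> I" for i t
    unfolding g_def using that finite_I by (intro member_le_sum) auto
  obtain t where t: "\<And>n. t n \<in> {0..<T}" "t \<longlonglongrightarrow> T" "\<And>i. i \<in> I \<Longrightarrow> (\<lambda>n. inv_height i (t n)) \<longlonglongrightarrow> w i"
    using lim by (auto simp: limit_configuration_def)
  have "(\<lambda>n. g (t n)) \<longlonglongrightarrow> (\<Sum>i\<in>I. \<bar>w i - w i\<bar>)"
    unfolding g_def by (intro tendsto_intros t)
  then have "\<forall>\<^sub>F n in sequentially. g (t n) < min d r"
    using r d by (intro order_tendstoD) auto
  moreover have "\<forall>\<^sub>F n in sequentially. T - d < t n"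
    using t(2) d by (intro order_tendstoD) auto
  ultimately have "\<forall>\<^sub>F n in sequentially. g (t n) < min d r \<and> T - d < t n"
    by (rule eventually_conj)
  then obtain n where n: "g (t n) < min d r" "T - d < t n"
    by (auto dest: eventually_happens)
  have "\<forall>\<^sub>F t' in at_left T. t' \<in> {t n<..<T}"
    using t(1)[of n] by (intro eventually_at_leftI[of "t n"]) auto
  from frequently_ex[OF frequently_eventually_frequently[OF freq this]] obtain b
    where b: "e \<le> \<bar>inv_height i0 b - w i0\<bar>" "t n < b" "b < T" by auto
  have "continuous_on {0..<T} g"
    unfolding g_def by (intro continuous_intros continuous_on_inv_height)
  then have "continuous_on {t n..b} g"
    by (rule continuous_on_subset) (use b t(1)[of n] in auto)
  moreover have "r \<le> g b" using g_ge[OF i0, of b] b r by linarith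
  ultimately obtain \<tau> where \<tau>: "\<tau> \<in> {t n..b}" "g \<tau> = r" "\<And>x. x \<in> {t n..\<tau>} \<Longrightarrow> g x \<le> r"
    using first_crossing[of "t n" b g r] b n by auto
  have "\<bar>inv_height i (t n) - w i\<bar> < d" if "i \<in> I" for i
    using g_ge[OF that, of "t n"] n by simp
  then show ?thesis
    using \<tau> t(1)[of n] n(2) b(3) unfolding g_def
    by (intro exI[of _ "t n"] exI[of _ \<tau>] conjI ballI) auto
qed

text \<open>The exit points of ever later excursions accumulate at a limit configuration \<open>q\<close> at distance exactly
\<open>r\<close> from \<open>w\<close>. During the excursions the clusters of \<open>w\<close> stay separated while the elapsed time
tends to \<open>0\<close>, so the weighted sum of the heights over each cluster is the same for \<open>q\<close> and \<open>w\<close>.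
If a cluster moved as a block, its nonzero total weight would force it not to move at all. Hence
\<open>q\<close> differs from \<open>w\<close> either by splitting a cluster or by a vortex that has come back from infinity.\<close>

lemma escape:
  assumes lim: "limit_configuration w" and i0: "i0 \<in> I"
    and not: "\<not> (inv_height i0 \<longlongrightarrow> w i0) (at_left T)"
  shows "\<exists>q. limit_configuration q \<and> num_clusters w < num_clusters q"
proof -
  have "\<exists>e>0. \<exists>\<^sub>F t in at_left T. e \<le> \<bar>inv_height i0 t - w i0\<bar>"
    using not by (simp add: tendsto_iff not_eventually dist_real_def not_less)
  then obtain e where e: "0 < e" "\<exists>\<^sub>F t in at_left T. e \<le> \<bar>inv_height i0 t - w i0\<bar>"
    by (elim exE conjE)
  obtain r where r: "0 < r" "r \<le> e"
    and sep: "\<And>i j. i \<in> I \<Longrightarrow> j \<in> I \<Longrightarrow> w i \<noteq> w j \<Longrightarrow> 4 * r \<le> \<bar>w i - w j\<bar>"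
    and sep0: "\<And>i. i \<in> I \<Longrightarrow> w i \<noteq> 0 \<Longrightarrow> 4 * r \<le> \<bar>w i\<bar>"
    using positive_separation[OF e(1), of w] by (elim exE conjE) blast
  define good where "good = (\<lambda>n s \<tau>. 0 \<le> s \<and> T - inverse (real (Suc n)) < s \<and> s \<le> \<tau> \<and> \<tau> < T \<and>
      (\<forall>i\<in>I. \<bar>inv_height i s - w i\<bar> < inverse (real (Suc n))) \<and>
      (\<forall>t\<in>{s..\<tau>}. (\<Sum>i\<in>I. \<bar>inv_height i t - w i\<bar>) \<le> r) \<and> (\<Sum>i\<in>I. \<bar>inv_height i \<tau> - w i\<bar>) = r)"
  have "\<exists>s \<tau>. good n s \<tau>" for n
    unfolding good_def by (rule excursion[OF lim i0 e(2) r]) simp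
  then have "\<exists>s \<tau>. \<forall>n. good n (s n) (\<tau> n)" by metis
  then obtain s \<tau> where g: "\<And>n. good n (s n) (\<tau> n)" by blast
  have s: "\<And>n. 0 \<le> s n" "\<And>n. T - inverse (real (Suc n)) < s n"
      "\<And>n. s n \<le> \<tau> n" "\<And>n. \<tau> n < T"
    and us: "\<And>n i. i \<in> I \<Longrightarrow> \<bar>inv_height i (s n) - w i\<bar> < inverse (real (Suc n))"
    and path: "\<And>n t. t \<in> {s n..\<tau> n} \<Longrightarrow> (\<Sum>i\<in>I. \<bar>inv_height i t - w i\<bar>) \<le> r"
    and exit: "\<And>n. (\<Sum>i\<in>I. \<bar>inv_height i (\<tau> n) - w i\<bar>) = r"
    using g by (auto simp: good_def)
  have path': "\<bar>inv_height i t - w i\<bar> \<le> r" if "i \<in> I" "t \<in> {s n..\<tau> n}" for i n t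
    using path[OF that(2)] member_le_sum[of i I "\<lambda>i. \<bar>inv_height i t - w i\<bar>"] that finite_I by simp
  have s_in: "s n \<in> {0..<T}" and \<tau>_in: "\<tau> n \<in> {0..<T}" for n
    using s(1,3,4)[of n] by auto
  have lb: "(\<lambda>n. T - inverse (real (Suc n))) \<longlonglongrightarrow> T"
    using tendsto_diff[OF tendsto_const[of T] LIMSEQ_inverse_real_of_nat] by simp
  have sT: "s \<longlonglongrightarrow> T"
    by (rule real_tendsto_sandwich[OF _ _ lb tendsto_const[of T]])
      (use s(2) s_in in \<open>auto intro!: always_eventually less_imp_le simp del: of_nat_Suc\<close>)
  have \<tau>T: "\<tau> \<longlonglongrightarrow> T"
    by (rule real_tendsto_sandwich[OF _ _ sT tendsto_const[of T]])
      (use s in \<open>auto intro!: always_eventually less_imp_le\<close>)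
  obtain q \<rho> where \<rho>: "strict_mono \<rho>" and q: "limit_configuration q"
    and uq: "\<And>i. i \<in> I \<Longrightarrow> (\<lambda>n. inv_height i (\<tau> (\<rho> n))) \<longlonglongrightarrow> q i"
    using limit_configuration_subseq[of \<tau>, OF \<tau>_in \<tau>T] by metis
  have near: "\<bar>q i - w i\<bar> \<le> r" if "i \<in> I" for i
    by (rule LIMSEQ_le_const2[OF tendsto_rabs[OF tendsto_diff[OF uq[OF that] tendsto_const]]])
      (intro exI allI impI path'[OF that], use s in auto)
  have "(\<lambda>n. \<Sum>i\<in>I. \<bar>inv_height i (\<tau> (\<rho> n)) - w i\<bar>) \<longlonglongrightarrow> (\<Sum>i\<in>I. \<bar>q i - w i\<bar>)"
    by (intro tendsto_intros uq)
  then have "(\<Sum>i\<in>I. \<bar>q i - w i\<bar>) = r"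
    unfolding exit by (simp add: LIMSEQ_const_iff)
  then have "\<exists>i\<in>I. q i \<noteq> w i" using r(1) by (intro ccontr[of "\<exists>i\<in>I. q i \<noteq> w i"]) simp
  then obtain i where i: "i \<in> I" "q i \<noteq> w i" by blast
  \<comment> \<open>Dividing by \<open>v\<close> is legitimate only for clusters at finite height, that is \<open>v \<noteq> 0\<close>.\<close>
  have center: "(\<Sum>j\<in>S. a j * (1 / q j)) = sum a S * (1 / v)"
    if S: "S = {j \<in> I. w j = v}" and v: "v \<noteq> 0" for S v
  proof -
    define B where "B = (\<lambda>t. \<Sum>j\<in>S. a j * H j t)"
    define L where "L = (\<Sum>i\<in>S. \<Sum>j\<in>I - S. \<bar>a i\<bar> * \<bar>a j\<bar> * (C / r))"
    have SI: "S \<subseteq> I" using S by auto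
    have B: "B t = (\<Sum>j\<in>S. a j * (1 / inv_height j t))" if "t \<in> {0..<T}" for t
      unfolding B_def using inv_height_bounds(3)[OF _ that] SI by (intro sum.cong) auto
    have "\<bar>B (\<tau> n) - B (s n)\<bar> \<le> L * (\<tau> n - s n)" for n
      unfolding B_def L_def
    proof (rule cluster_sum_lipschitz)
      fix t j k assume t: "t \<in> {s n..\<tau> n}" and j: "j \<in> S" and k: "k \<in> I - S"
      have "4 * r \<le> \<bar>w j - w k\<bar>" using j k S by (intro sep) auto
      moreover have "\<bar>inv_height j t - w j\<bar> \<le> r" "\<bar>inv_height k t - w k\<bar> \<le> r"
        using path'[OF _ t] j k SI by auto
      moreover have "\<bar>inv_height j t - inv_height k t\<bar> \<le> \<bar>H j t - H k t\<bar>"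
        using j k SI t s(1,4)[of n] by (intro inv_height_diff_le) auto
      ultimately show "r \<le> \<bar>H j t - H k t\<bar>" using r by linarith
    qed (use s SI r in auto)
    then have le: "\<forall>\<^sub>F n in sequentially. norm (B (\<tau> n) - B (s n)) \<le> L * (\<tau> n - s n)" by simp
    have "(\<lambda>n. L * (\<tau> n - s n)) \<longlonglongrightarrow> L * (T - T)"
      by (intro tendsto_intros \<tau>T sT)
    then have "(\<lambda>n. L * (\<tau> n - s n)) \<longlonglongrightarrow> 0" by simp
    from Lim_null_comparison[OF le this]
    have "(\<lambda>n. B (\<tau> n) - B (s n)) \<longlonglongrightarrow> 0" .
    then have 1: "(\<lambda>n. B (\<tau> (\<rho> n)) - B (s (\<rho> n))) \<longlonglongrightarrow> 0"
      by (rule LIMSEQ_subseq_LIMSEQ[OF _ \<rho>, unfolded o_def])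
    have us': "(\<lambda>n. inv_height j (s n)) \<longlonglongrightarrow> w j" if "j \<in> I" for j
    proof -
      have "(\<lambda>n. inv_height j (s n) - w j) \<longlonglongrightarrow> 0"
        by (rule Lim_null_comparison[OF always_eventually LIMSEQ_inverse_real_of_nat])
          (use us[OF that] in \<open>auto intro: less_imp_le simp del: of_nat_Suc\<close>)
      then show ?thesis by (simp add: LIM_zero_iff)
    qed
    have "(\<lambda>n. \<Sum>j\<in>S. a j * (1 / inv_height j (s n))) \<longlonglongrightarrow> (\<Sum>j\<in>S. a j * (1 / w j))"
      by (intro tendsto_intros us') (use S v in auto)
    then have "(\<lambda>n. B (s n)) \<longlonglongrightarrow> (\<Sum>j\<in>S. a j * (1 / w j))"
      using s_in by (simp add: B)
    then have 2: "(\<lambda>n. B (s (\<rho> n))) \<longlonglongrightarrow> (\<Sum>j\<in>S. a j * (1 / w j))"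
      by (rule LIMSEQ_subseq_LIMSEQ[OF _ \<rho>, unfolded o_def])
    have "q j \<noteq> 0" if "j \<in> S" for j
      using near[of j] sep0[of j] that S v r by auto
    then have "(\<lambda>n. \<Sum>j\<in>S. a j * (1 / inv_height j (\<tau> (\<rho> n)))) \<longlonglongrightarrow> (\<Sum>j\<in>S. a j * (1 / q j))"
      by (intro tendsto_intros uq) (use SI in auto)
    then have "(\<lambda>n. B (\<tau> (\<rho> n))) \<longlonglongrightarrow> (\<Sum>j\<in>S. a j * (1 / q j))"
      using \<tau>_in by (simp add: B)
    from LIMSEQ_unique[OF 1 tendsto_diff[OF this 2]]
    have "(\<Sum>j\<in>S. a j * (1 / q j)) = (\<Sum>j\<in>S. a j * (1 / w j))" by simp
    also have "\<dots> = (\<Sum>j\<in>S. a j * (1 / v))" using S by (intro sum.cong) auto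
    finally show ?thesis by (simp only: sum_distrib_right)
  qed
  have split: "\<exists>j\<in>I. w j = w i \<and> q j \<noteq> q i" if w: "w i \<noteq> 0"
  proof (rule ccontr)
    assume "\<not> ?thesis"
    then have const: "q j = q i" if "j \<in> I" "w j = w i" for j
      using that by blast
    define S where "S = {j \<in> I. w j = w i}"
    have "sum a S * (1 / q i) = (\<Sum>j\<in>S. a j * (1 / q j))"
      unfolding sum_distrib_right using const by (intro sum.cong) (auto simp: S_def)
    also have "\<dots> = sum a S * (1 / w i)" by (rule center[OF S_def w])
    finally have "sum a S * (1 / q i) = sum a S * (1 / w i)" .
    moreover have "sum a S \<noteq> 0" using i(1) by (intro nonneutral) (auto simp: S_def)
    ultimately have "1 / q i = 1 / w i" by simp
    then show False using i(2) w by simp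
  qed
  obtain j where j: "j \<in> I" "w j = w i" "w i \<noteq> 0 \<Longrightarrow> q j \<noteq> q i"
  proof (cases "w i = 0")
    case True
    then show ?thesis using that[of i] i(1) by simp
  next
    case False
    then show ?thesis using split that by blast
  qed
  have "num_clusters w < num_clusters q"
    by (rule num_clusters_less_if_split[OF r(1) sep sep0 near i(1) j(1,2)]) (use i j(3) in simp_all)
  then show ?thesis using q by blast
qed

text \<open>By \<open>escape\<close> a limit configuration with the largest possible number of clusters is the
limit of the whole trajectory.\<close>

lemma inv_height_convergent:
  obtains w where "\<And>i. i \<in> I \<Longrightarrow> (inv_height i \<longlongrightarrow> w i) (at_left T)"
proof -
  have "num_clusters w < Suc (card I)" for w
    unfolding num_clusters_def using finite_I
    by (meson Diff_subset card_image_le card_mono finite_imageI le_imp_less_Suc order_trans)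
  then have bd: "\<forall>w. limit_configuration w \<longrightarrow> num_clusters w < Suc (card I)" by blast
  obtain w0 where "limit_configuration w0" using limit_configuration_exists by blast
  from ex_has_greatest_nat[of limit_configuration, OF this bd] obtain w where
    w: "limit_configuration w" "\<forall>q. limit_configuration q \<longrightarrow> num_clusters q \<le> num_clusters w"
    by blast
  show ?thesis
  proof (rule that[of w], rule ccontr)
    fix i assume "i \<in> I" "\<not> (inv_height i \<longlongrightarrow> w i) (at_left T)"
    from escape[OF w(1) this] w(2) show False using leD by blast
  qed
qed

text \<open>Convergence is what synchronizes the vortices: each descends to height \<open>1\<close> along its own sequence of
times, and the existence of the limits makes all of them descend together.\<close>

lemma total_zero_of_common_descent:
  assumes "\<And>i e. i \<in> I \<Longrightarrow> 0 < e \<Longrightarrow> \<exists>\<^sub>F t in at_left T. H i t < 1 + e"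
  shows "(\<Sum>i\<in>I. a i * (H i 0 - 1)) = 0"
proof -
  obtain w where w: "\<And>i. i \<in> I \<Longrightarrow> (inv_height i \<longlongrightarrow> w i) (at_left T)"
    using inv_height_convergent by blast
  have ev: "\<forall>\<^sub>F t in at_left T. t \<in> {0..<T}"
    using T_pos by (intro eventually_at_leftI[of 0]) auto
  have w1: "w i = 1" if i: "i \<in> I" for i
  proof (rule antisym)
    show "w i \<le> 1"
      by (rule tendsto_upperbound[OF w[OF i]])
        (use ev inv_height_bounds(2)[OF i] in \<open>auto elim: eventually_mono\<close>)
    show "1 \<le> w i"
    proof (rule ccontr)
      assume "\<not> 1 \<le> w i"
      then obtain c where c: "max 0 (w i) < c" "c < 1" using dense[of "max 0 (w i)" 1] by auto
      have "\<forall>\<^sub>F t in at_left T. inv_height i t < c" using w[OF i] c by (intro order_tendstoD) auto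
      with ev have evc: "\<forall>\<^sub>F t in at_left T. 1 / c \<le> H i t"
      proof eventually_elim
        case (elim t)
        then show ?case using H_ge_1[OF i, of t] c by (simp add: inv_height_def field_simps)
      qed
      have "0 < 1 / c - 1" using c by (simp add: field_simps)
      from frequently_eventually_frequently[OF assms[OF i this] evc]
      show False by (auto dest: frequently_ex)
    qed
  qed
  have "((\<lambda>t. \<Sum>i\<in>I. a i * (1 / inv_height i t - 1)) \<longlongrightarrow> (\<Sum>i\<in>I. a i * (1 / 1 - 1))) (at_left T)"
    using w w1 by (intro tendsto_intros) auto
  moreover have "\<forall>\<^sub>F t in at_left T. (\<Sum>i\<in>I. a i * (1 / inv_height i t - 1)) = (\<Sum>i\<in>I. a i * (H i 0 - 1))"
    using ev
  proof eventually_elim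
    case (elim t)
    then show ?case
      using total_conserved[OF elim] by (simp add: inv_height_def right_diff_distrib sum_subtractf)
  qed
  ultimately have "((\<lambda>t. \<Sum>i\<in>I. a i * (H i 0 - 1)) \<longlongrightarrow> 0) (at_left T)"
    by (simp add: tendsto_cong)
  then show ?thesis by (simp add: tendsto_const_iff)
qed

end

section \<open>Heights of point vortices\<close>

primrec height :: "vortex_domain \<Rightarrow> complex \<Rightarrow> real" where
  "height Half_Plane z = Im z"
| "height Disk z = 1 - (norm z)\<^sup>2"

primrec dheight :: "vortex_domain \<Rightarrow> complex \<Rightarrow> complex \<Rightarrow> real" where
  "dheight Half_Plane z v = Im v"
| "dheight Disk z v = - 2 * (z \<bullet> v)"

text \<open>The rate at which a vortex of unit intensity at \<open>y\<close> changes the height of a vortex at \<open>x\<close>. The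
first factor is a multiple of the component of \<open>x - y\<close> along the boundary: horizontal for the half
plane, and orthogonal to \<open>x\<close> for the disk, where it is the determinant of \<open>x\<close> and \<open>x - y\<close>. The
negative term in the bracket is the effect of the image of \<open>y\<close> behind the boundary.\<close>

primrec flux :: "vortex_domain \<Rightarrow> complex \<Rightarrow> complex \<Rightarrow> real" where
  "flux Half_Plane x y =
     (Re x - Re y) / (2 * pi) * (1 / (norm (x - y))\<^sup>2 - 1 / (norm (x - cnj y))\<^sup>2)"
| "flux Disk x y =
     (Im x * Re y - Re x * Im y) / pi * (1 / (norm (x - y))\<^sup>2 - 1 / (norm (x * cnj y - 1))\<^sup>2)"

text \<open>Both Green functions are logarithms of a quotient of distances, that is, of square roots of
quadratic polynomials in each coordinate.\<close>

lemma deriv_log_ratio: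
  fixes P Q :: "real \<Rightarrow> real"
  assumes "(P has_field_derivative P') (at s)" "(Q has_field_derivative Q') (at s)"
    and "P s > 0" "Q s > 0"
  shows "deriv (\<lambda>s. c * ln (sqrt (P s) / sqrt (Q s))) s = c / 2 * (P' / P s - Q' / Q s)"
proof (rule DERIV_imp_deriv)
  have *: "c * (1 / (u / v) * ((P' * (inverse u / 2) * v - u * (Q' * (inverse v / 2))) / (v * v)))
      = c / 2 * (P' / u\<^sup>2 - Q' / v\<^sup>2)" if "u > 0" "v > 0" for u v :: real
    using that by (simp add: field_simps power2_eq_square)
  have "((\<lambda>s. c * ln (sqrt (P s) / sqrt (Q s))) has_field_derivative
      c * (1 / (sqrt (P s) / sqrt (Q s)) * ((P' * (inverse (sqrt (P s)) / 2) * sqrt (Q s)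
         - sqrt (P s) * (Q' * (inverse (sqrt (Q s)) / 2))) / (sqrt (Q s) * sqrt (Q s))))) (at s)"
    using assms by (auto intro!: derivative_eq_intros simp: mult_ac)
  then show "((\<lambda>s. c * ln (sqrt (P s) / sqrt (Q s))) has_field_derivative
      c / 2 * (P' / P s - Q' / Q s)) (at s)"
    using assms by (subst (asm) *) auto
qed

text \<open>The mirror image of a vortex is further away than the vortex itself; in the disk the distance to
the image \<open>1 / cnj y\<close> is rescaled by \<open>norm y\<close>. Therefore the contribution of the
image to the flux does not exceed that of the vortex, and the Green function has no singularity
other than the diagonal.\<close>

lemma norm_reflected_half_plane:
  assumes "Im x > 0" "Im y > 0"
  shows "norm (x - y) \<le> norm (x - cnj y)"
proof -
  have "(Im x - Im y)\<^sup>2 \<le> (Im x + Im y)\<^sup>2"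
    using assms by (intro abs_le_square_iff[THEN iffD1]) auto
  then show ?thesis by (simp add: cmod_def)
qed

lemma norm_reflected_disk:
  assumes "norm x < 1" "norm y < 1"
  shows "norm (x - y) \<le> norm (x * cnj y - 1)"
proof -
  have "(1 - (norm x)\<^sup>2) * (1 - (norm y)\<^sup>2) \<ge> 0"
    using assms by (simp add: abs_square_le_1 power_le_one)
  moreover have "(norm (x * cnj y - 1))\<^sup>2 - (norm (x - y))\<^sup>2 = (1 - (norm x)\<^sup>2) * (1 - (norm y)\<^sup>2)"
    unfolding cmod_power2 by (simp add: power2_eq_square) algebra
  ultimately show ?thesis
    by (intro power2_le_imp_le[OF _ norm_ge_zero]) linarith
qed

text \<open>The radial component of a perpendicular gradient is an angular derivative. For the disk the two
quadratic polynomials in the Green function have the same angular derivative, here \<open>2 * m\<close>, which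
is why the flux factorizes.\<close>

lemma coordinate_curl:
  fixes r s b c d e m p q k :: real
  assumes "r * b - s * c = 2 * m" "r * d - s * e = 2 * m"
  shows "- 2 * (r * - (1 / (2 * k) / 2 * (b / p - d / q)) + s * (1 / (2 * k) / 2 * (c / p - e / q)))
      = m / k * (1 / p - 1 / q)"
proof -
  have "- 2 * (r * - (l / 2 * (b / p - d / q)) + s * (l / 2 * (c / p - e / q)))
      = l * ((r * b - s * c) * (1 / p) - (r * d - s * e) * (1 / q))" for l
    by (simp add: diff_divide_distrib algebra_simps)
  from this[of "1 / (2 * k)"] show ?thesis
    unfolding assms by (simp add: right_diff_distrib)
qed

lemma dheight_nabla_perp_green:
  assumes "x \<in> region \<Omega>" "y \<in> region \<Omega>" "x \<noteq> y"
  shows "dheight \<Omega> x (nabla_perp (\<lambda>z. green \<Omega> z y) x) = flux \<Omega> x y"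
proof (cases \<Omega>)
  case Half_Plane
  let ?P = "\<lambda>s. (s - Re y)\<^sup>2 + (Im x - Im y)\<^sup>2"
  let ?Q = "\<lambda>s. (s - Re y)\<^sup>2 + (Im x + Im y)\<^sup>2"
  have n: "norm (x - y) > 0" "norm (x - cnj y) > 0"
    using assms Half_Plane norm_reflected_half_plane[of x y] by (auto intro: less_le_trans)
  have PQ: "?P (Re x) = (norm (x - y))\<^sup>2" "?Q (Re x) = (norm (x - cnj y))\<^sup>2"
    by (simp_all add: cmod_power2)
  have 1: "deriv (\<lambda>s. 1 / (2 * pi) * ln (sqrt (?P s) / sqrt (?Q s))) (Re x)
     = 1 / (2 * pi) / 2 * (2 * (Re x - Re y) / ?P (Re x) - 2 * (Re x - Re y) / ?Q (Re x))"
    by (rule deriv_log_ratio) (use n PQ in \<open>auto intro!: derivative_eq_intros\<close>)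
  have g: "green Half_Plane (Complex s (Im x)) y = 1 / (2 * pi) * ln (sqrt (?P s) / sqrt (?Q s))" for s
    by (simp add: cmod_def)
  define p q where "p = (norm (x - y))\<^sup>2" and "q = (norm (x - cnj y))\<^sup>2"
  have pq: "p > 0" "q > 0" using n by (auto simp: p_def q_def)
  have "1 / (2 * pi) / 2 * (2 * (Re x - Re y) / p - 2 * (Re x - Re y) / q)
      = (Re x - Re y) / (2 * pi) * (1 / p - 1 / q)"
    using pq by (simp add: field_simps)
  then show ?thesis
    unfolding Half_Plane nabla_perp_def g 1
    unfolding PQ p_def[symmetric] q_def[symmetric] flux.simps dheight.simps by simp
next
  case Disk
  let ?q = "\<lambda>s b. (s * Re y + b * Im y - 1)\<^sup>2 + (b * Re y - s * Im y)\<^sup>2"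
  let ?p = "\<lambda>s b. (s - Re y)\<^sup>2 + (b - Im y)\<^sup>2"
  have n: "norm (x - y) > 0" "norm (x * cnj y - 1) > 0"
    using assms Disk norm_reflected_disk[of x y] by (auto intro: less_le_trans)
  have PQ: "?p (Re x) (Im x) = (norm (x - y))\<^sup>2" "?q (Re x) (Im x) = (norm (x * cnj y - 1))\<^sup>2"
    by (simp_all add: cmod_power2)
  have 1: "deriv (\<lambda>s. 1 / (2 * pi) * ln (sqrt (?p s (Im x)) / sqrt (?q s (Im x)))) (Re x)
     = 1 / (2 * pi) / 2 * (2 * (Re x - Re y) / ?p (Re x) (Im x)
        - (2 * Re y * (Re x * Re y + Im x * Im y - 1) - 2 * Im y * (Im x * Re y - Re x * Im y)) / ?q (Re x) (Im x))"
    by (rule deriv_log_ratio) (use n PQ in \<open>auto intro!: derivative_eq_intros simp: algebra_simps\<close>)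
  have 2: "deriv (\<lambda>s. 1 / (2 * pi) * ln (sqrt (?p (Re x) s) / sqrt (?q (Re x) s))) (Im x)
     = 1 / (2 * pi) / 2 * (2 * (Im x - Im y) / ?p (Re x) (Im x)
        - (2 * Im y * (Re x * Re y + Im x * Im y - 1) + 2 * Re y * (Im x * Re y - Re x * Im y)) / ?q (Re x) (Im x))"
    by (rule deriv_log_ratio) (use n PQ in \<open>auto intro!: derivative_eq_intros simp: algebra_simps\<close>)
  have g: "green Disk (Complex s b) y = 1 / (2 * pi) * ln (sqrt (?p s b) / sqrt (?q s b))" for s b
    by (simp add: cmod_def)
  define p q where "p = (norm (x - y))\<^sup>2" and "q = (norm (x * cnj y - 1))\<^sup>2"
  show ?thesis
    unfolding Disk nabla_perp_def g 1 2
    unfolding PQ p_def[symmetric] q_def[symmetric] flux.simps dheight.simps inner_complex_def complex.sel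
    by (rule coordinate_curl) (simp_all add: algebra_simps)
qed

text \<open>The Robin function depends on the height only, so the velocity it induces is parallel to the
boundary.\<close>

lemma dheight_nabla_perp_robin:
  assumes "x \<in> region \<Omega>"
  shows "dheight \<Omega> x (nabla_perp (robin \<Omega>) x) = 0"
proof (cases \<Omega>)
  case Half_Plane
  then show ?thesis by (simp add: nabla_perp_def)
next
  case Disk
  have p: "1 - ((Re x)\<^sup>2 + (Im x)\<^sup>2) > 0"
    using assms Disk by (simp add: cmod_def)
  have 1: "deriv (\<lambda>s. - 1 / (2 * pi) * ln (1 - (s\<^sup>2 + (Im x)\<^sup>2))) (Re x)
     = - 1 / (2 * pi) * (1 / (1 - ((Re x)\<^sup>2 + (Im x)\<^sup>2)) * (- 2 * Re x))"
    by (rule DERIV_imp_deriv) (use p in \<open>auto intro!: derivative_eq_intros\<close>)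
  have 2: "deriv (\<lambda>s. - 1 / (2 * pi) * ln (1 - ((Re x)\<^sup>2 + s\<^sup>2))) (Im x)
     = - 1 / (2 * pi) * (1 / (1 - ((Re x)\<^sup>2 + (Im x)\<^sup>2)) * (- 2 * Im x))"
    by (rule DERIV_imp_deriv) (use p in \<open>auto intro!: derivative_eq_intros\<close>)
  have g: "robin Disk (Complex s b) = - 1 / (2 * pi) * ln (1 - (s\<^sup>2 + b\<^sup>2))" for s b
    by (simp add: cmod_power2)
  show ?thesis
    unfolding Disk nabla_perp_def g 1 2 by (simp add: inner_complex_def)
qed

text \<open>Infinitesimally this is the invariance of the Green function under the translations, or rotations, of
the domain.\<close>

lemma flux_antisym: "flux \<Omega> x y = - flux \<Omega> y x"
proof -
  have h: "norm (x - cnj y) = norm (y - cnj x)"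
    by (subst complex_mod_cnj[symmetric]) (simp add: norm_minus_commute)
  have d: "norm (x * cnj y - 1) = norm (y * cnj x - 1)"
    by (subst complex_mod_cnj[symmetric]) (simp add: mult.commute)
  have swap: "(r - s) / c * e = - ((s - r) / c * e)" for r s c e :: real
    by (simp add: diff_divide_distrib algebra_simps)
  show ?thesis
  proof (cases \<Omega>)
    case Half_Plane
    show ?thesis
      unfolding Half_Plane flux.simps norm_minus_commute[of x y] h by (rule swap)
  next
    case Disk
    show ?thesis
      unfolding Disk flux.simps norm_minus_commute[of x y] d
      unfolding mult.commute[of "Im y"] mult.commute[of "Re y"] by (rule swap)
  qed
qed

text \<open>The flux is at most of the order of the inverse distance \<open>d\<close>: its first factor is bounded by a multiple
of \<open>d\<close> and the bracket by the inverse square of \<open>d\<close>, as the image term is the smaller one. The heights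
are Lipschitz functions, which compensates the remaining singularity.\<close>

lemma flux_bound:
  assumes "x \<in> region \<Omega>" "y \<in> region \<Omega>"
  shows "\<bar>flux \<Omega> x y\<bar> * \<bar>height \<Omega> x - height \<Omega> y\<bar> \<le> 2 / pi"
proof (cases "x = y")
  case False
  define d where "d = norm (x - y)"
  have d: "d > 0" using False by (simp add: d_def)
  have diff: "\<bar>1 / d\<^sup>2 - 1 / e\<^sup>2\<bar> \<le> 1 / d\<^sup>2" if "d \<le> e" for e
  proof -
    have "1 / e\<^sup>2 \<le> 1 / d\<^sup>2" using that d by (intro divide_left_mono) (auto intro!: power_mono)
    then show ?thesis by simp
  qed
  have main: "\<bar>m / c * (1 / d\<^sup>2 - 1 / e\<^sup>2)\<bar> * k \<le> b / c"
    if "d \<le> e" "\<bar>m\<bar> \<le> d" "0 \<le> k" "k \<le> b * d" "c > 0" for m c e k b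
  proof -
    have "\<bar>m / c * (1 / d\<^sup>2 - 1 / e\<^sup>2)\<bar> * k \<le> (d / c * (1 / d\<^sup>2)) * (b * d)"
      unfolding abs_mult using that d diff[OF that(1)]
      by (intro mult_mono) (auto simp: field_simps)
    also have "\<dots> = b / c" using d that by (simp add: power2_eq_square field_simps)
    finally show ?thesis .
  qed
  show ?thesis
  proof (cases \<Omega>)
    case Half_Plane
    have "\<bar>Re x - Re y\<bar> \<le> d" "\<bar>Im x - Im y\<bar> \<le> d"
      unfolding d_def using abs_Re_le_cmod[of "x - y"] abs_Im_le_cmod[of "x - y"] by auto
    moreover have "d \<le> norm (x - cnj y)"
      unfolding d_def using assms Half_Plane by (intro norm_reflected_half_plane) auto
    ultimately have "\<bar>flux \<Omega> x y\<bar> * \<bar>height \<Omega> x - height \<Omega> y\<bar> \<le> 1 / (2 * pi)"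
      using main[of "norm (x - cnj y)" "Re x - Re y" "\<bar>Im x - Im y\<bar>" 1 "2 * pi"] Half_Plane
      by (simp add: d_def)
    also have "\<dots> \<le> 2 / pi" by (simp add: field_simps)
    finally show ?thesis .
  next
    case Disk
    have x: "norm x < 1" and y: "norm y < 1" using assms Disk by auto
    have "\<bar>Im x * Re y - Re x * Im y\<bar> = \<bar>Im (cnj x * (x - y))\<bar>"
      by (simp add: algebra_simps)
    also have "\<dots> \<le> norm x * norm (x - y)"
      by (metis abs_Im_le_cmod complex_mod_cnj norm_mult)
    also have "\<dots> \<le> d" unfolding d_def using x by (simp add: mult_left_le_one_le)
    finally have m: "\<bar>Im x * Re y - Re x * Im y\<bar> \<le> d" .
    have "(norm y)\<^sup>2 - (norm x)\<^sup>2 = (norm y + norm x) * (norm y - norm x)"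
      by (simp add: power2_eq_square algebra_simps)
    then have "\<bar>(norm y)\<^sup>2 - (norm x)\<^sup>2\<bar> = (norm y + norm x) * \<bar>norm y - norm x\<bar>"
      by (simp add: abs_mult)
    also have "\<dots> \<le> 2 * d"
      unfolding d_def using x y norm_triangle_ineq3[of y x]
      by (intro mult_mono) (auto simp: norm_minus_commute)
    finally have k: "\<bar>(norm y)\<^sup>2 - (norm x)\<^sup>2\<bar> \<le> 2 * d" .
    have "d \<le> norm (x * cnj y - 1)"
      unfolding d_def using x y by (rule norm_reflected_disk)
    from main[OF this m _ k] show ?thesis
      using Disk by (simp add: d_def)
  qed
qed simp

lemma has_derivative_height:
  assumes "(x has_vector_derivative v) (at t within A)"
  shows "((\<lambda>t. height \<Omega> (x t)) has_field_derivative dheight \<Omega> (x t) v) (at t within A)"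
proof (cases \<Omega>)
  case Half_Plane
  then show ?thesis
    using assms by (auto simp: has_vector_derivative_complex_iff)
next
  case Disk
  have D: "((\<lambda>t. 1 - ((p t)\<^sup>2 + (q t)\<^sup>2)) has_field_derivative - 2 * (p t * p' + q t * q'))
      (at t within A)"
    if "(p has_field_derivative p') (at t within A)" "(q has_field_derivative q') (at t within A)"
    for p q :: "real \<Rightarrow> real" and p' q'
    using that by (auto intro!: derivative_eq_intros simp: algebra_simps)
  show ?thesis
    unfolding Disk height.simps dheight.simps cmod_power2 inner_complex_def
    using assms by (intro D) (auto simp: has_vector_derivative_complex_iff)
qed

lemma height_pos:
  assumes "z \<in> region \<Omega>"
  shows "height \<Omega> z > 0"
  using assms by (cases \<Omega>) (auto simp: abs_square_less_1)

lemma height_le_infdist: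
  assumes "z \<in> region \<Omega>"
  shows "height \<Omega> z \<le> 2 * infdist z (frontier (region \<Omega>))"
proof -
  have op: "open (region \<Omega>)"
    by (cases \<Omega>) (auto simp: open_halfspace_Im_gt)
  have "region \<Omega> \<noteq> UNIV" 
  proof -
    have "-1 \<notin> region \<Omega>" by (cases \<Omega>) auto
    then show ?thesis by blast
  qed
  then have ne: "frontier (region \<Omega>) \<noteq> {}"
    using assms by (auto simp: frontier_eq_empty)
  have "height \<Omega> z / 2 \<le> dist z y" if "y \<in> frontier (region \<Omega>)" for y
  proof -
    have "y \<notin> region \<Omega>" using that op by (simp add: frontier_def interior_open)
    show ?thesis
    proof (cases \<Omega>)
      case Half_Plane
      then have "Im z \<le> Im (z - y)" "Im z > 0" using \<open>y \<notin> _\<close> assms by auto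
      then show ?thesis using abs_Im_le_cmod[of "z - y"] Half_Plane by (simp add: dist_norm)
    next
      case Disk
      then have "1 \<le> norm y" "norm z < 1" using \<open>y \<notin> _\<close> assms by auto
      moreover have "norm y \<le> norm z + dist z y"
        using norm_triangle_ineq2[of y z] by (simp add: dist_norm norm_minus_commute)
      moreover have "1 - (norm z)\<^sup>2 \<le> 2 * (1 - norm z)"
        using zero_le_power2[of "1 - norm z"] by (simp add: power2_eq_square algebra_simps)
      ultimately show ?thesis using Disk by simp
    qed
  qed
  then have "height \<Omega> z / 2 \<le> infdist z (frontier (region \<Omega>))"
    unfolding infdist_notempty[OF ne] using ne by (intro cINF_greatest) auto
  then show ?thesis by simp
qed

lemma linear_dheight: "linear (dheight \<Omega> z)"
  by (cases \<Omega>) (auto intro!: linearI simp: inner_add_right algebra_simps)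

lemma height_derivative:
  assumes sol: "point_vortex_solution \<Omega> N a x0 T x" and t: "t \<in> {0..<T}" and i: "i \<in> {1..N}"
  shows "((\<lambda>t. 1 + height \<Omega> (x i t)) has_field_derivative
    (\<Sum>j\<in>{1..N} - {i}. a j * flux \<Omega> (x i t) (x j t))) (at t within {0..<T})"
proof -
  have reg: "x k t \<in> region \<Omega>" if "k \<in> {1..N}" for k
    using sol t that unfolding point_vortex_solution_def by blast
  have ne: "x i t \<noteq> x j t" if "j \<in> {1..N} - {i}" for j
    using sol t that i unfolding point_vortex_solution_def inj_on_def by blast
  define v where "v = (\<Sum>j\<in>{1..N} - {i}. a j *\<^sub>R nabla_perp (\<lambda>z. green \<Omega> z (x j t)) (x i t))
           + (a i / 2) *\<^sub>R nabla_perp (robin \<Omega>) (x i t)"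
  have "(x i has_vector_derivative v) (at t within {0..<T})"
    using sol t i unfolding point_vortex_solution_def v_def by blast
  from has_derivative_height[OF this, of \<Omega>]
  have "((\<lambda>t. 1 + height \<Omega> (x i t)) has_field_derivative 0 + dheight \<Omega> (x i t) v) (at t within {0..<T})"
    by (intro DERIV_add DERIV_const)
  moreover have "dheight \<Omega> (x i t) v
      = (\<Sum>j\<in>{1..N} - {i}. a j * dheight \<Omega> (x i t) (nabla_perp (\<lambda>z. green \<Omega> z (x j t)) (x i t)))"
    unfolding v_def
    by (simp add: linear_add[OF linear_dheight] linear_scale[OF linear_dheight]
        linear_sum[OF linear_dheight] dheight_nabla_perp_robin[OF reg[OF i]])
  moreover have "\<dots> = (\<Sum>j\<in>{1..N} - {i}. a j * flux \<Omega> (x i t) (x j t))"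
    using reg i ne by (intro sum.cong refl arg_cong2[of _ _ _ _ "(*)"] dheight_nabla_perp_green) auto
  ultimately show ?thesis by simp
qed

lemma frequently_low_of_boundary_collision:
  assumes sol: "point_vortex_solution \<Omega> N a x0 T x" and T: "0 < T" and e: "0 < e"
    and i: "i \<in> boundary_collision_set \<Omega> N T x"
  shows "\<exists>\<^sub>F t in at_left T. height \<Omega> (x i t) < e"
proof (rule ccontr)
  let ?d = "\<lambda>t. infdist (x i t) (frontier (region \<Omega>))"
  assume "\<not> ?thesis"
  then have "\<forall>\<^sub>F t in at_left T. e \<le> height \<Omega> (x i t)"
    by (simp add: not_frequently not_less)
  moreover have "\<forall>\<^sub>F t in at_left T. t \<in> {0..<T}"
    using T by (intro eventually_at_leftI[of 0]) auto
  ultimately have "\<forall>\<^sub>F t in at_left T. ereal (e / 2) \<le> ereal (?d t)"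
  proof eventually_elim
    case (elim t)
    have "x i t \<in> region \<Omega>"
      using sol elim(2) i unfolding point_vortex_solution_def boundary_collision_set_def by blast
    from height_le_infdist[OF this] elim(1) show ?case by simp
  qed
  then have "ereal (e / 2) \<le> Liminf (at_left T) (\<lambda>t. ereal (?d t))"
    by (rule Liminf_bounded)
  then show False using i e by (simp add: boundary_collision_set_def)
qed

section \<open>Not all vortices reach the boundary\<close>

theorem theoremB1:
  fixes \<Omega> :: vortex_domain and N :: nat and a :: "nat \<Rightarrow> real"
    and x0 :: "nat \<Rightarrow> complex" and T :: real and x :: "nat \<Rightarrow> real \<Rightarrow> complex"
  assumes "N \<ge> 1"
    and "\<forall>i\<in>{1..N}. a i \<noteq> 0"
    and "\<forall>S. S \<subseteq> {1..N} \<and> S \<noteq> {} \<longrightarrow> (\<Sum>i\<in>S. a i) \<noteq> 0"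
    and "\<forall>i\<in>{1..N}. x0 i \<in> region \<Omega>"
    and "inj_on x0 {1..N}"
    and "T > 0"
    and "point_vortex_solution \<Omega> N a x0 T x"
    and "(\<Omega> = Half_Plane \<and> vorticity_vector N a x0 \<bullet> Complex 0 1 \<noteq> 0) \<or>
         (\<Omega> = Disk \<and> moment_of_inertia N a x0 \<noteq> (\<Sum>i=1..N. a i))"
  shows "boundary_collision_set \<Omega> N T x \<noteq> {1..N}"
proof
  assume all: "boundary_collision_set \<Omega> N T x = {1..N}"
  note sol = \<open>point_vortex_solution \<Omega> N a x0 T x\<close>
  have reg: "x i t \<in> region \<Omega>" if "i \<in> {1..N}" "t \<in> {0..<T}" for i t
    using sol that unfolding point_vortex_solution_def by blast
  interpret interacting_heights "{1..N}" a "\<lambda>i t. 1 + height \<Omega> (x i t)"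
    "\<lambda>i j t. flux \<Omega> (x i t) (x j t)" "2 / pi" T
  proof
    show "1 \<le> 1 + height \<Omega> (x i t)" if "i \<in> {1..N}" "t \<in> {0..<T}" for i t
      using height_pos[OF reg[OF that]] by simp
    show "\<bar>flux \<Omega> (x i t) (x j t)\<bar> * \<bar>1 + height \<Omega> (x i t) - (1 + height \<Omega> (x j t))\<bar> \<le> 2 / pi"
      if "i \<in> {1..N}" "j \<in> {1..N}" "t \<in> {0..<T}" for i j t
      using flux_bound[OF reg[OF that(1,3)] reg[OF that(2,3)]] by simp
    show "((\<lambda>t. 1 + height \<Omega> (x i t)) has_field_derivative
        (\<Sum>j\<in>{1..N} - {i}. a j * flux \<Omega> (x i t) (x j t))) (at t within {0..<T})"
      if "i \<in> {1..N}" "t \<in> {0..<T}" for i t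
      using height_derivative[OF sol that(2,1)] .
    show "flux \<Omega> (x i t) (x j t) = - flux \<Omega> (x j t) (x i t)" for i j t
      by (rule flux_antisym)
  qed (use assms in auto)
  have "(\<Sum>i\<in>{1..N}. a i * (1 + height \<Omega> (x i 0) - 1)) = 0"
  proof (rule total_zero_of_common_descent)
    fix i and e :: real
    assume "i \<in> {1..N}" "0 < e"
    then show "\<exists>\<^sub>F t in at_left T. 1 + height \<Omega> (x i t) < 1 + e"
      using frequently_low_of_boundary_collision[OF sol \<open>T > 0\<close>, of e i] all by simp
  qed
  moreover have "x i 0 = x0 i" if "i \<in> {1..N}" for i
    using sol that unfolding point_vortex_solution_def by blast
  ultimately have total: "(\<Sum>i=1..N. a i * height \<Omega> (x0 i)) = 0" by simp
  show False
  proof (cases \<Omega>)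
    case Half_Plane
    have "vorticity_vector N a x0 \<bullet> Complex 0 1 = (\<Sum>i=1..N. a i * Im (x0 i))"
      by (simp add: vorticity_vector_def inner_complex_def)
    then show False using assms(8) total Half_Plane by simp
  next
    case Disk
    have "(\<Sum>i=1..N. a i * height Disk (x0 i)) = (\<Sum>i=1..N. a i) - moment_of_inertia N a x0"
      by (simp add: moment_of_inertia_def right_diff_distrib sum_subtractf)
    then show False using assms(8) total Disk by simp
  qed
qed

end
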